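(* Let $A$ and $B$ be quantum systems of arbitrary finite dimension and let $\mathcal S$ be the SWAP channel between $A$ and $B$, regarded as a bipartite unitary channel with Alice's input $A$, Bob's input $B$, Alice's output $A'=B$ and Bob's output $B'=A$. Then $$\Sigma(\mathcal S)=\frac{2(d_A^2-1)}{d_A^2}.$$ Moreover, in the expression $$\Sigma(\mathcal S)=\max_{\rho\in\mathsf{St}(EA)}\Big\|\rho-\rho_E\otimes\frac{I}{d_A}\Big\|_1\qquad(E\cong A,\ \rho_E=\mathrm{Tr}_A\rho),$$ the maximum is achieved by any maximally entangled state $\rho$ of $EA$.
   Context: All systems are finite-dimensional quantum systems; system $X$ has complex Hilbert space $\mathcal H_X$ of dimension $d_X$, and the composite system $XY$ has Hilbert space $\mathcal H_X\otimes\mathcal H_Y$. $\mathsf{St}(X)$ is the set of density operators on $\mathcal H_X$. $\mathfrak C(X,Y)$ is the set of quantum channels (completely positive trace-preserving linear maps) from operators on $\mathcal H_X$ to operators on $\mathcal H_Y$. $\mathcal I_X$ is the identity channel on $X$ and $I$ is the identity operator on $\mathcal H_A$. $\|X\|_1=\mathrm{Tr}\sqrt{X^\dagger X}$. For a Hermitian-preserving linear map $\mathcal L$ with input system $X$, the diamond norm is $\|\mathcal L\|_\diamond=\sup_{\rho\in\mathsf{St}(EX)}\|(\mathcal I_E\otimes\mathcal L)(\rho)\|_1$ with $E\cong X$. A maximally entangled state of $EA$ with $E\cong A$ is a pure state whose marginals are maximally mixed. For a bipartite unitary channel $\mathcal U:\rho\mapsto U\rho U^\dagger$ with $U:\mathcal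 H_A\otimes\mathcal H_B\to\mathcal H_{A'}\otimes\mathcal H_{B'}$ unitary, the signalling of $\mathcal U$ (from $A$ to $B'$) is $$\Sigma(\mathcal U)=\inf_{\mathcal C\in\mathfrak C(B,B')}\|(\mathrm{Tr}_{A'}\otimes\mathcal I_{B'})\circ\mathcal U-\mathrm{Tr}_A\otimes\mathcal C\|_\diamond .$$ The SWAP gate is the unitary $S:\mathcal H_A\otimes\mathcal H_B\to\mathcal H_B\otimes\mathcal H_A$, $S(|\psi\rangle\otimes|\varphi\rangle)=|\varphi\rangle\otimes|\psi\rangle$, and $\mathcal S$ is the corresponding channel $\rho\mapsto S\rho S^\dagger$. *)

theory Defs
  imports "HOL-Analysis.Analysis"
begin

text \<open>
  A quantum system of dimension \<open>d\<close> is modelled by \<open>complex ^ 'x\<close>, where \<open>'x\<close> is a finite index type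
  with \<open>CARD('x) = d\<close>; the composite of systems indexed by \<open>'x\<close> and \<open>'y\<close> is indexed by \<open>'x \<times> 'y\<close>.
  An operator from \<open>complex ^ 'x\<close> to \<open>complex ^ 'y\<close> is a matrix in \<open>complex ^ 'x ^ 'y\<close>.
\<close>

section \<open>Operators\<close>

definition cinner :: "complex ^ 'x \<Rightarrow> complex ^ 'x \<Rightarrow> complex" where
  "cinner v w = (\<Sum>i\<in>UNIV. cnj (v $ i) * w $ i)"

definition dagger :: "complex ^ 'x ^ 'y \<Rightarrow> complex ^ 'y ^ 'x" where
  "dagger M = transpose (map_matrix cnj M)"

definition cscale :: "complex \<Rightarrow> complex ^ 'x ^ 'y \<Rightarrow> complex ^ 'x ^ 'y" where
  "cscale c M = map_matrix ((*) c) M"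

definition psd :: "complex ^ 'x ^ 'x \<Rightarrow> bool" where
  "psd M \<longleftrightarrow> (\<forall>v. cinner v (M *v v) \<in> nonneg_Reals)"

definition psd_sqrt :: "complex ^ 'x ^ 'x \<Rightarrow> complex ^ 'x ^ 'x" where
  "psd_sqrt M = (THE R. psd R \<and> R ** R = M)"

definition trace_norm :: "complex ^ 'x ^ 'x \<Rightarrow> real" where
  "trace_norm M = Re (trace (psd_sqrt (dagger M ** M)))"

definition unitary_op :: "complex ^ 'x ^ 'y \<Rightarrow> bool" where
  "unitary_op U \<longleftrightarrow> dagger U ** U = mat 1 \<and> U ** dagger U = mat 1"

definition tensor_vec :: "complex ^ 'x \<Rightarrow> complex ^ 'y \<Rightarrow> complex ^ ('x::finite \<times> 'y::finite)" where
  "tensor_vec v w = (\<chi> p. v $ fst p * w $ snd p)"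

definition tensor_op ::
    "complex ^ 'x ^ 'x \<Rightarrow> complex ^ 'y ^ 'y \<Rightarrow> complex ^ ('x::finite \<times> 'y::finite) ^ ('x \<times> 'y)" where
  "tensor_op M N = (\<chi> p q. M $ fst p $ fst q * N $ snd p $ snd q)"

text \<open>\<open>tr_fst\<close> traces out the first tensor factor, \<open>tr_snd\<close> the second.\<close>

definition tr_fst :: "complex ^ ('x::finite \<times> 'y::finite) ^ ('x \<times> 'y) \<Rightarrow> complex ^ 'y ^ 'y" where
  "tr_fst M = (\<chi> y y'. \<Sum>x\<in>UNIV. M $ (x, y) $ (x, y'))"

definition tr_snd :: "complex ^ ('x::finite \<times> 'y::finite) ^ ('x \<times> 'y) \<Rightarrow> complex ^ 'x ^ 'x" where
  "tr_snd M = (\<chi> x x'. \<Sum>y\<in>UNIV. M $ (x, y) $ (x', y))"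

section \<open>States\<close>

definition density_ops :: "(complex ^ 'x ^ 'x) set" where
  "density_ops = {\<rho>. psd \<rho> \<and> trace \<rho> = 1}"

definition pure_state :: "complex ^ 'x ^ 'x \<Rightarrow> bool" where
  "pure_state \<rho> \<longleftrightarrow> (\<exists>\<psi>. cinner \<psi> \<psi> = 1 \<and> \<rho> = (\<chi> i j. \<psi> $ i * cnj (\<psi> $ j)))"

definition maximally_mixed :: "complex ^ 'x ^ 'x" where
  "maximally_mixed = mat (1 / of_nat CARD('x))"

definition maximally_entangled :: "complex ^ ('x::finite \<times> 'y::finite) ^ ('x \<times> 'y) \<Rightarrow> bool" where
  "maximally_entangled \<rho> \<longleftrightarrow>
     pure_state \<rho> \<and> tr_snd \<rho> = maximally_mixed \<and> tr_fst \<rho> = maximally_mixed"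

section \<open>Channels\<close>

text \<open>
  A family \<open>M i j\<close> with \<open>i, j < n\<close> is an operator on the tensor product of an \<open>n\<close>-dimensional ancilla
  with \<open>complex ^ 'x\<close>, given by its blocks; a vector of that space is a family \<open>v i\<close>.
  The extension of \<open>L\<close> by the identity map on the ancilla is \<open>\<lambda>i j. L (M i j)\<close>. Using blocks allows
  the definition of complete positivity to quantify over the ancilla dimension.
\<close>

definition block_psd :: "nat \<Rightarrow> (nat \<Rightarrow> nat \<Rightarrow> complex ^ 'x ^ 'x) \<Rightarrow> bool" where
  "block_psd n M \<longleftrightarrow>
     (\<forall>v :: nat \<Rightarrow> complex ^ 'x. (\<Sum>i<n. \<Sum>j<n. cinner (v i) (M i j *v v j)) \<in> nonneg_Reals)"

definition completely_positive :: "(complex ^ 'x ^ 'x \<Rightarrow> complex ^ 'y ^ 'y) \<Rightarrow> bool" where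
  "completely_positive L \<longleftrightarrow> (\<forall>n M. block_psd n M \<longrightarrow> block_psd n (\<lambda>i j. L (M i j)))"

definition channels :: "(complex ^ 'x ^ 'x \<Rightarrow> complex ^ 'y ^ 'y) set" where
  "channels = {L. Vector_Spaces.linear cscale cscale L \<and> completely_positive L \<and>
                  (\<forall>M. trace (L M) = trace M)}"

text \<open>\<open>id_tensor L\<close> is the tensor product of the identity map on the first factor with a linear
  map \<open>L\<close>: it applies \<open>L\<close> to every block of the argument.\<close>

definition id_tensor ::
    "(complex ^ 'x ^ 'x \<Rightarrow> complex ^ 'y ^ 'y) \<Rightarrow>
     complex ^ ('e::finite \<times> 'x::finite) ^ ('e \<times> 'x) \<Rightarrow> complex ^ ('e \<times> 'y) ^ ('e \<times> 'y)" where
  "id_tensor L M =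
     (\<chi> p q. L (\<chi> x x'. M $ (fst p, x) $ (fst q, x')) $ snd p $ snd q)"

definition diamond_norm :: "(complex ^ 'x ^ 'x \<Rightarrow> complex ^ 'y ^ 'y) \<Rightarrow> real" where
  "diamond_norm L =
     (SUP \<rho> \<in> (density_ops :: (complex ^ ('x::finite \<times> 'x) ^ ('x \<times> 'x)) set). trace_norm (id_tensor L \<rho>))"

definition unitary_channel :: "complex ^ 'x ^ 'y \<Rightarrow> complex ^ 'x ^ 'x \<Rightarrow> complex ^ 'y ^ 'y" where
  "unitary_channel U M = U ** M ** dagger U"

section \<open>Signalling\<close>

text \<open>Index types: \<open>'a\<close>, \<open>'b\<close> for the inputs of Alice and Bob, \<open>'c\<close>, \<open>'d\<close> for their outputs.
  The map \<open>\<lambda>M. C (tr_fst M)\<close> is the tensor product of the trace on \<open>'a\<close> with \<open>C\<close>.\<close>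

definition signalling :: "complex ^ ('a::finite \<times> 'b::finite) ^ ('c::finite \<times> 'd::finite) \<Rightarrow> real" where
  "signalling U =
     (INF C \<in> (channels :: (complex ^ 'b ^ 'b \<Rightarrow> complex ^ 'd ^ 'd) set).
        diamond_norm (\<lambda>M. tr_fst (unitary_channel U M) - C (tr_fst M)))"

section \<open>The SWAP gate\<close>

definition swap_op :: "complex ^ ('a::finite \<times> 'b::finite) ^ ('b \<times> 'a)" where
  "swap_op = (\<chi> p q. if fst p = snd q \<and> snd p = fst q then 1 else 0)"

lemma swap_op_tensor_vec:
  fixes v :: "complex ^ 'a::finite" and w :: "complex ^ 'b::finite"
  shows "swap_op *v tensor_vec v w = tensor_vec w v"
proof -
  have "(\<Sum>q\<in>UNIV. (if fst p = snd q \<and> snd p = fst q then 1 else 0) * (v $ fst q * w $ snd q))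
        = w $ fst p * v $ snd p" for p :: "'b \<times> 'a"
  proof -
    have "(\<Sum>q\<in>UNIV. (if fst p = snd q \<and> snd p = fst q then 1 else 0) * (v $ fst q * w $ snd q))
        = (\<Sum>q\<in>UNIV. if q = (snd p, fst p) then v $ fst q * w $ snd q else 0)"
      by (intro sum.cong) (auto simp: prod_eq_iff)
    then show ?thesis
      by (simp add: mult.commute)
  qed
  then show ?thesis
    by (simp add: swap_op_def tensor_vec_def matrix_vector_mult_def vec_eq_iff)
qed

lemma unitary_op_swap_op:
  "unitary_op (swap_op :: complex ^ ('a::finite \<times> 'b::finite) ^ ('b \<times> 'a))"
proof -
  have dag: "dagger (swap_op :: complex ^ ('x::finite \<times> 'y::finite) ^ ('y \<times> 'x)) = swap_op"
    by (auto simp: dagger_def swap_op_def transpose_def map_matrix_def vec_eq_iff)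
  have sq: "swap_op ** swap_op = (mat 1 :: complex ^ ('x::finite \<times> 'y::finite) ^ ('x \<times> 'y))"
  proof -
    have "(\<Sum>r\<in>UNIV. (if fst p = snd r \<and> snd p = fst r then 1 else 0) *
             (if fst r = snd q \<and> snd r = fst q then 1 else 0)) = (if p = q then 1 else (0::complex))"
      for p q :: "'x \<times> 'y"
    proof -
      have "(\<Sum>r\<in>UNIV. (if fst p = snd r \<and> snd p = fst r then 1 else 0) *
             (if fst r = snd q \<and> snd r = fst q then 1 else 0)) =
            (\<Sum>r\<in>UNIV. if r = (snd p, fst p) then (if p = q then 1 else (0::complex)) else 0)"
        by (intro sum.cong) (auto simp: prod_eq_iff)
      then show ?thesis by simp
    qed
    then show ?thesis
      by (simp add: swap_op_def matrix_matrix_mult_def mat_def vec_eq_iff)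
  qed
  show ?thesis
    by (simp add: unitary_op_def dag sq)
qed

end

theory Submission
  imports Defs
begin

text \<open>
  Write \<open>d = d\<^sub>A\<close>. A positive \<open>\<rho>\<close> satisfies \<open>\<rho> \<le> d \<rho>\<^sub>E \<otimes> I\<close>, so
  \<open>\<rho> - \<rho>\<^sub>E \<otimes> I/d = (1 - 1/d^2) \<rho> - (\<rho>\<^sub>E \<otimes> I/d - \<rho>/d^2)\<close> is a difference of two positive
  operators of trace \<open>1 - 1/d^2\<close>. Its trace norm is therefore at most \<open>2 (1 - 1/d^2)\<close>, which bounds
  the signalling through the channel that prepares \<open>I/d\<close>.

  Conversely, a traceless Hermitian \<open>H\<close> has trace norm at least \<open>2 \<langle>\<psi>, H \<psi>\<rangle>\<close> for every unit vector
  \<open>\<psi>\<close>. For a maximally entangled \<open>\<psi>\<close> the overlap with any product \<open>I/d \<otimes> \<gamma>\<close>, \<open>\<gamma>\<close> a state, is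
  \<open>1/d^2\<close>. Hence the input \<open>|\<psi>\<rangle>\<langle>\<psi>| \<otimes> |b\<rangle>\<langle>b|\<close> gives the lower bound \<open>2 (1 - 1/d^2)\<close> whatever
  channel \<open>C\<close> is subtracted, since \<open>C\<close> enters only through \<open>\<gamma> = C(|b\<rangle>\<langle>b|)\<close>.
\<close>

section \<open>The complex inner product\<close>

text \<open>Pushes conditionals outwards, so that sums over Kronecker deltas collapse one index at a
  time.\<close>

lemma if_zero:
  fixes a b :: complex
  shows "(if P then a else 0) * b = (if P then a * b else 0)"
    and "b * (if P then a else 0) = (if P then b * a else 0)"
    and "(if P then a else 0) / b = (if P then a / b else 0)"
    and "cnj (if P then a else 0) = (if P then cnj a else 0)"
    and "(\<Sum>x\<in>S. if P then f x else 0) = (if P then \<Sum>x\<in>S. f x else 0)"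
  by auto

lemma sum_rotate:
  "(\<Sum>i\<in>A. \<Sum>j\<in>B. \<Sum>k\<in>C. f i j k) = (\<Sum>k\<in>C. \<Sum>i\<in>A. \<Sum>j\<in>B. f i j k)"
  by (subst (2) sum.swap, intro sum.cong refl sum.swap)

lemma cinner_zero_right: "cinner v 0 = 0"
  by (simp add: cinner_def)

lemma cinner_add_left: "cinner (u + v) w = cinner u w + cinner v w"
  by (simp add: cinner_def algebra_simps sum.distrib)

lemma cinner_add_right: "cinner w (u + v) = cinner w u + cinner w v"
  by (simp add: cinner_def algebra_simps sum.distrib)

lemma cinner_diff_left: "cinner (u - v) w = cinner u w - cinner v w"
  by (simp add: cinner_def algebra_simps sum_subtractf)

lemma cinner_diff_right: "cinner w (u - v) = cinner w u - cinner w v"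
  by (simp add: cinner_def algebra_simps sum_subtractf)

lemma cinner_scale_left: "cinner (c *s v) w = cnj c * cinner v w"
  by (simp add: cinner_def vector_scalar_mult_def sum_distrib_left algebra_simps)

lemma cinner_scale_right: "cinner w (c *s v) = c * cinner w v"
  by (simp add: cinner_def vector_scalar_mult_def sum_distrib_left algebra_simps)

lemma cinner_sum_right: "cinner w (\<Sum>k\<in>S. f k) = (\<Sum>k\<in>S. cinner w (f k))"
  by (simp add: cinner_def sum_distrib_left sum.swap[of _ UNIV])

lemma cinner_sum_left: "cinner (\<Sum>k\<in>S. f k) w = (\<Sum>k\<in>S. cinner (f k) w)"
  by (simp add: cinner_def sum_distrib_right sum.swap[of _ UNIV])

lemma cnj_cinner: "cnj (cinner v w) = cinner w v"
  by (simp add: cinner_def mult.commute)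

lemma cinner_mult_commute: "cinner v w * cinner w v = of_real ((cmod (cinner v w))\<^sup>2)"
  by (metis cnj_cinner complex_norm_square of_real_power)

lemma cinner_axis_left: "cinner (axis i 1) v = v $ i"
proof -
  have "cinner (axis i 1) v = (\<Sum>j\<in>UNIV. if j = i then v $ j else 0)"
    unfolding cinner_def by (intro sum.cong) (auto simp: axis_def)
  then show ?thesis by simp
qed

lemma cinner_axis_right: "cinner v (axis i 1) = cnj (v $ i)"
  by (metis cinner_axis_left cnj_cinner)

lemma inner_eq_Re_cinner: "inner v w = Re (cinner v w)" for v w :: "complex ^ 'n"
  by (simp add: inner_vec_def cinner_def inner_complex_def)

lemma cinner_self: "cinner v v = of_real ((norm v)\<^sup>2)"
proof -
  have "Im (cinner v v) = 0"
    by (simp add: cinner_def)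
  moreover have "Re (cinner v v) = (norm v)\<^sup>2"
    by (simp add: power2_norm_eq_inner inner_eq_Re_cinner)
  ultimately show ?thesis
    by (simp add: complex_eq_iff)
qed

section \<open>Adjoints, matrix entries and Hermitian operators\<close>

lemma cinner_adjoint: "cinner v (M *v w) = cinner (dagger M *v v) w"
proof -
  have "cinner v (M *v w) = (\<Sum>i\<in>UNIV. \<Sum>j\<in>UNIV. cnj (v $ i) * M $ i $ j * w $ j)"
    by (simp add: cinner_def matrix_vector_mult_def sum_distrib_left mult.assoc)
  also have "\<dots> = (\<Sum>j\<in>UNIV. \<Sum>i\<in>UNIV. cnj (v $ i) * M $ i $ j * w $ j)"
    by (rule sum.swap)
  also have "\<dots> = cinner (dagger M *v v) w"
    by (simp add: cinner_def matrix_vector_mult_def dagger_def transpose_def map_matrix_def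
        sum_distrib_right sum_distrib_left algebra_simps)
  finally show ?thesis .
qed

lemma matrix_scale_right: "M *v (c *s v) = c *s (M *v v)" for M :: "complex ^ 'n ^ 'm"
  by (simp add: matrix_vector_mult_def vector_scalar_mult_def vec_eq_iff sum_distrib_left algebra_simps)

lemma matrix_entry_eq_cinner: "M $ i $ j = cinner (axis i 1) (M *v axis j 1)"
proof -
  have "(M *v axis j 1) $ i = (\<Sum>k\<in>UNIV. if k = j then M $ i $ k else 0)"
    by (simp add: matrix_vector_mult_def axis_def if_zero cong: if_cong)
  then show ?thesis by (simp add: cinner_axis_left)
qed

lemma mat_mult_vec: "mat c *v v = c *s v" for c :: complex
  by (simp add: mat_def matrix_vector_mult_def vec_eq_iff if_zero)

text \<open>Polarization: a complex quadratic form with only real values comes from a Hermitian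
  operator.\<close>

lemma psd_hermitian:
  assumes "psd M"
  shows "dagger M = M"
proof -
  have re: "Im (cinner v (M *v v)) = 0" for v
    using assms by (simp add: psd_def complex_nonneg_Reals_iff)
  have sym: "cinner w (M *v v) = cnj (cinner v (M *v w))" for v w
  proof -
    \<comment> \<open>The cross terms of the form at \<open>v + c *s w\<close> are real because all
      the other terms are.\<close>
    have *: "Im (c * cinner v (M *v w) + cnj c * cinner w (M *v v)) = 0" for c
    proof -
      have "cinner (v + c *s w) (M *v (v + c *s w)) = cinner v (M *v v)
          + cnj c * c * cinner w (M *v w) + (c * cinner v (M *v w) + cnj c * cinner w (M *v v))"
        by (simp add: matrix_vector_right_distrib matrix_scale_right cinner_add_left
            cinner_add_right cinner_scale_left cinner_scale_right algebra_simps)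
      moreover have "Im (cnj c * c * cinner w (M *v w)) = 0"
        using re[of w] by (simp add: algebra_simps)
      ultimately show ?thesis
        using re[of v] re[of "v + c *s w"] by (metis add_0 plus_complex.simps(2))
    qed
    \<comment> \<open>The choice \<open>c = 1\<close> makes the imaginary parts opposite, and
      \<open>c = \<i>\<close> makes the real parts equal.\<close>
    show ?thesis
      using *[of 1] *[of \<i>] by (simp add: complex_eq_iff)
  qed
  have "cnj (M $ j $ i) = M $ i $ j" for i j
    using sym[of "axis i 1" "axis j 1"] by (simp only: matrix_entry_eq_cinner)
  then show ?thesis
    by (simp add: dagger_def transpose_def map_matrix_def vec_eq_iff)
qed

lemma hermitian_cinner: "dagger H = H \<Longrightarrow> cinner v (H *v w) = cinner (H *v v) w"
  by (metis cinner_adjoint)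

lemma hermitian_diff: "dagger P = P \<Longrightarrow> dagger Q = Q \<Longrightarrow> dagger (P - Q) = P - Q"
  by (simp add: dagger_def transpose_def map_matrix_def vec_eq_iff)

section \<open>Spectral decomposition\<close>

text \<open>A maximizer \<open>x\<close> of the Rayleigh quotient makes \<open>\<lambda> - f\<close> a positive semidefinite form on
  \<open>V\<close> with \<open>x\<close> isotropic, so \<open>x\<close> lies in its kernel.\<close>

lemma self_adjoint_eigenvector:
  fixes f :: "'v::euclidean_space \<Rightarrow> 'v"
  assumes f: "linear f" and adj: "\<And>x y. inner x (f y) = inner (f x) y"
    and V: "subspace V" "\<And>x. x \<in> V \<Longrightarrow> f x \<in> V" and z: "z \<in> V" "z \<noteq> 0"
  obtains x l where "x \<in> V" "norm x = 1" "f x = l *\<^sub>R x"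
proof -
  let ?S = "V \<inter> sphere 0 1"
  have "compact ?S"
    using V by (intro closed_Int_compact closed_subspace) auto
  moreover have "(1 / norm z) *\<^sub>R z \<in> ?S"
    using z V by (simp add: subspace_scale)
  then have "?S \<noteq> {}" by blast
  moreover have "continuous_on ?S (\<lambda>x. inner x (f x))"
    using f by (intro continuous_intros linear_continuous_on linear_linear[THEN iffD2]) auto
  ultimately obtain x where x: "x \<in> ?S" and max: "\<And>y. y \<in> ?S \<Longrightarrow> inner y (f y) \<le> inner x (f x)"
    using continuous_attains_sup[of ?S "\<lambda>x. inner x (f x)"] by blast
  define l where "l = inner x (f x)"
  define g where "g = (\<lambda>y. l *\<^sub>R y - f y)"
  have pos: "inner y (g y) \<ge> 0" if "y \<in> V" for y
  proof (cases "y = 0")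
    case False
    have "(1 / norm y) *\<^sub>R y \<in> ?S"
      using False that V by (simp add: subspace_scale)
    from max[OF this] have "inner y (f y) / (norm y)\<^sup>2 \<le> l"
      by (simp add: l_def linear_scale[OF f] power2_eq_square)
    then show ?thesis
      using False by (simp add: g_def inner_diff_right divide_le_eq power2_norm_eq_inner)
  qed (simp add: g_def linear_0[OF f])
  have gx: "inner x (g x) = 0"
    using x by (simp add: g_def l_def inner_diff_right flip: power2_norm_eq_inner)
  have g_adj: "inner a (g b) = inner (g a) b" for a b
    by (simp add: g_def inner_diff_right inner_diff_left adj)
  define y where "y = g x"
  have y: "y \<in> V"
    using x V by (simp add: y_def g_def subspace_diff subspace_scale)
  \<comment> \<open>Positivity at \<open>x - t *\<^sub>R y\<close>, divided by \<open>t\<close>. The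
    constant term vanishes by \<open>gx\<close>, so letting \<open>t\<close> tend to 0 from the
    right forces the residual \<open>y = g x\<close> to vanish.\<close>
  have le: "2 * (norm y)\<^sup>2 \<le> t * inner y (g y)" if "t > 0" for t
  proof -
    have g_diff: "g (x - t *\<^sub>R y) = g x - t *\<^sub>R g y"
      by (simp add: g_def linear_diff[OF f] linear_scale[OF f] algebra_simps)
    have "0 \<le> inner (x - t *\<^sub>R y) (g (x - t *\<^sub>R y))"
      using x y V by (intro pos) (simp add: subspace_diff subspace_scale)
    also have "\<dots> = t * (t * inner y (g y) - 2 * (norm y)\<^sup>2)"
      using gx g_adj[of x y]
      by (simp add: g_diff inner_diff_right inner_diff_left power2_norm_eq_inner algebra_simps
          flip: y_def)
    finally show ?thesis
      using that by (simp add: zero_le_mult_iff)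
  qed
  have "((\<lambda>t. t * inner y (g y)) \<longlongrightarrow> 0 * inner y (g y)) (at_right 0)"
    by (intro tendsto_intros)
  moreover have "eventually (\<lambda>t. 2 * (norm y)\<^sup>2 \<le> t * inner y (g y)) (at_right 0)"
    using le by (simp add: eventually_at_filter)
  ultimately have "2 * (norm y)\<^sup>2 \<le> 0 * inner y (g y)"
    by (intro tendsto_lowerbound[where F = "at_right 0"]) auto
  then have "f x = l *\<^sub>R x"
    by (simp add: y_def g_def)
  with that x show ?thesis by auto
qed

text \<open>A set rather than an indexed family, so that eigenvalues can be a function of the basis
  vector. Completeness is stated as the expansion in which it is used.\<close>

definition orthonormal_basis :: "(complex ^ 'n) set \<Rightarrow> bool" where
  "orthonormal_basis B \<longleftrightarrow> finite B \<and>
     (\<forall>b\<in>B. \<forall>c\<in>B. cinner b c = (if b = c then 1 else 0)) \<and>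
     (\<forall>v. v = (\<Sum>b\<in>B. cinner b v *s b))"

text \<open>Take a largest orthonormal set of eigenvectors with real eigenvalues. Its orthogonal
  complement is invariant under \<open>H\<close>, so a nonzero vector there would yield one more
  eigenvector; hence the complement is zero.\<close>

lemma hermitian_eigenbasis:
  fixes H :: "complex ^ 'n ^ 'n"
  assumes H: "dagger H = H"
  obtains B and l :: "complex ^ 'n \<Rightarrow> real"
  where "orthonormal_basis B" "\<And>b. b \<in> B \<Longrightarrow> H *v b = of_real (l b) *s b"
proof -
  define ok where "ok B \<longleftrightarrow> (\<forall>b\<in>B. \<forall>c\<in>B. cinner b c = (if b = c then 1 else 0)) \<and>
     (\<forall>b\<in>B. \<exists>r::real. H *v b = of_real r *s b)" for B
  \<comment> \<open>Such a set is also orthogonal for the real inner product, so the real dimension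
    bounds its size.\<close>
  have bound: "finite B \<and> card B \<le> DIM(complex ^ 'n)" if "ok B" for B
  proof -
    have "pairwise orthogonal B"
      using that by (auto simp: ok_def pairwise_def orthogonal_def inner_eq_Re_cinner)
    moreover have "0 \<notin> B"
      using that by (force simp: ok_def cinner_self)
    ultimately have "independent B"
      by (rule pairwise_orthogonal_independent)
    then show ?thesis by (rule independent_bound)
  qed
  have "ok {}" by (simp add: ok_def)
  then have "\<exists>B. ok B \<and> (\<forall>B'. ok B' \<longrightarrow> card B' \<le> card B)"
    using bound
    by (intro ex_has_greatest_nat[of ok "{}" card "DIM(complex ^ 'n) + 1"])
      (auto simp: le_imp_less_Suc)
  then obtain B where B: "ok B" and max: "\<And>B'. ok B' \<Longrightarrow> card B' \<le> card B" by blast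
  have fin: "finite B" using bound B by blast
  have on: "cinner b c = (if b = c then 1 else 0)" if "b \<in> B" "c \<in> B" for b c
    using B that by (simp add: ok_def)
  \<comment> \<open>The orthogonal complement of \<open>B\<close>. It is used as a real subspace, so
    the eigenvalue found in it is real.\<close>
  define V where "V = {x. \<forall>b\<in>B. cinner b x = 0}"
  have V0: "x = 0" if "x \<in> V" for x
  proof (rule ccontr)
    assume "x \<noteq> 0"
    have scaleR: "r *\<^sub>R v = of_real r *s v" for r and v :: "complex ^ 'n"
      by (simp add: vec_eq_iff complex_eq_iff)
    have "subspace V"
      by (auto simp: subspace_def V_def cinner_zero_right cinner_add_right cinner_scale_right scaleR)
    moreover have "H *v y \<in> V" if "y \<in> V" for y
    proof -
      have "cinner b (H *v y) = 0" if "b \<in> B" for b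
      proof -
        obtain r :: real where "H *v b = of_real r *s b"
          using B \<open>b \<in> B\<close> unfolding ok_def by blast
        then show ?thesis
          using \<open>y \<in> V\<close> \<open>b \<in> B\<close> by (simp add: hermitian_cinner[OF H] cinner_scale_left V_def)
      qed
      then show ?thesis by (simp add: V_def)
    qed
    ultimately obtain y r where y: "y \<in> V" "norm y = 1" "H *v y = r *\<^sub>R y"
      using self_adjoint_eigenvector[of "(*v) H" V x] \<open>x \<in> V\<close> \<open>x \<noteq> 0\<close>
      by (auto simp: matrix_vector_mul_linear inner_eq_Re_cinner hermitian_cinner[OF H])
    have y': "y \<notin> B"
      using y on by (auto simp: V_def)
    have "cinner y b = 0" if "b \<in> B" for b
      using y that by (metis (mono_tags, lifting) V_def cnj_cinner complex_cnj_zero mem_Collect_eq)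
    then have "ok (insert y B)"
      using B y y' unfolding ok_def by (auto simp: V_def cinner_self scaleR)
    with max fin y' show False by fastforce
  qed
  have "v = (\<Sum>b\<in>B. cinner b v *s b)" for v
  proof -
    have "cinner c (\<Sum>b\<in>B. cinner b v *s b) = cinner c v" if "c \<in> B" for c
    proof -
      have "cinner c (\<Sum>b\<in>B. cinner b v *s b) = (\<Sum>b\<in>B. if b = c then cinner b v else 0)"
        unfolding cinner_sum_right using on that by (intro sum.cong) (auto simp: cinner_scale_right)
      then show ?thesis using fin that by simp
    qed
    then have "v - (\<Sum>b\<in>B. cinner b v *s b) \<in> V"
      by (simp add: V_def cinner_diff_right)
    then show ?thesis using V0 by fastforce
  qed
  then have "orthonormal_basis B"
    using fin on by (simp add: orthonormal_basis_def)
  moreover obtain l :: "complex ^ 'n \<Rightarrow> real" where "\<And>b. b \<in> B \<Longrightarrow> H *v b = of_real (l b) *s b"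
    using B unfolding ok_def by metis
  ultimately show ?thesis using that by blast
qed

section \<open>Expansions in an orthonormal basis\<close>

lemma matrix_eq_on_basis:
  assumes B: "orthonormal_basis B" and eq: "\<And>b. b \<in> B \<Longrightarrow> M *v b = N *v b"
  shows "M = N"
proof -
  have exp: "A *v v = (\<Sum>b\<in>B. cinner b v *s (A *v b))" for A :: "complex ^ 'a ^ 'b" and v
  proof -
    have "v = (\<Sum>b\<in>B. cinner b v *s b)"
      using B unfolding orthonormal_basis_def by blast
    then have "A *v v = A *v (\<Sum>b\<in>B. cinner b v *s b)" by simp
    then show ?thesis
      by (simp add: linear_sum[OF matrix_vector_mul_linear] matrix_scale_right)
  qed
  have "M *v v = N *v v" for v
    unfolding exp[of M v] exp[of N v] using eq by simp
  then show ?thesis by (simp add: matrix_eq)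
qed

lemma cinner_basis:
  assumes "orthonormal_basis B"
  shows "cinner v w = (\<Sum>b\<in>B. cinner v b * cinner b w)"
proof -
  have "w = (\<Sum>b\<in>B. cinner b w *s b)"
    using assms unfolding orthonormal_basis_def by blast
  then have "cinner v w = cinner v (\<Sum>b\<in>B. cinner b w *s b)" by simp
  then show ?thesis by (simp add: cinner_sum_right cinner_scale_right mult.commute)
qed

text \<open>Expand each diagonal entry in \<open>B\<close>, exchange the sums, and resum over the
  standard basis.\<close>

lemma trace_basis:
  assumes "orthonormal_basis B"
  shows "trace M = (\<Sum>b\<in>B. cinner b (M *v b))"
proof -
  have "trace M = (\<Sum>i\<in>UNIV. cinner (axis i 1) (M *v axis i 1))"
    by (simp add: trace_def flip: matrix_entry_eq_cinner)
  also have "\<dots> = (\<Sum>i\<in>UNIV. \<Sum>b\<in>B. cinner (dagger M *v axis i 1) b * cinner b (axis i 1))"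
    by (intro sum.cong refl) (simp only: cinner_adjoint cinner_basis[OF assms, symmetric])
  also have "\<dots> = (\<Sum>b\<in>B. \<Sum>i\<in>UNIV. cinner b (axis i 1) * cinner (axis i 1) (M *v b))"
    by (subst sum.swap) (simp add: mult.commute flip: cinner_adjoint)
  also have "\<dots> = (\<Sum>b\<in>B. cinner b (M *v b))"
  proof (rule sum.cong[OF refl])
    fix b
    have "(\<Sum>i\<in>UNIV. cinner b (axis i 1) * cinner (axis i 1) (M *v b)) =
        (\<Sum>i\<in>UNIV. cnj (b $ i) * (M *v b) $ i)"
      by (simp add: cinner_axis_left cinner_axis_right)
    then show "(\<Sum>i\<in>UNIV. cinner b (axis i 1) * cinner (axis i 1) (M *v b)) = cinner b (M *v b)"
      by (simp add: cinner_def)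
  qed
  finally show ?thesis .
qed

section \<open>The trace norm of a Hermitian operator\<close>

text \<open>Makes the description in \<open>psd_sqrt\<close> well defined. With
  \<open>D = R - S\<close> one has \<open>R D + D S = 0\<close>. On a unit eigenvector of
  \<open>D\<close> with eigenvalue \<open>l\<close> this reads \<open>l (r + s) = 0\<close>, where
  \<open>l = r - s\<close> and \<open>r\<close>, \<open>s\<close> are nonnegative, so
  \<open>l = 0\<close>.\<close>

lemma psd_sqrt_unique:
  assumes R: "psd R" and S: "psd S" and eq: "R ** R = S ** S"
  shows "R = S"
proof -
  have H: "dagger (R - S) = R - S"
    using R S by (intro hermitian_diff psd_hermitian)
  obtain B l where B: "orthonormal_basis B"
    and l: "\<And>b. b \<in> B \<Longrightarrow> (R - S) *v b = of_real (l b) *s b"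
    using hermitian_eigenbasis[OF H] by blast
  show ?thesis
  proof (rule matrix_eq_on_basis[OF B])
    fix b assume b: "b \<in> B"
    let ?r = "cinner b (R *v b)" and ?s = "cinner b (S *v b)"
    have bb: "cinner b b = 1" using B b by (simp add: orthonormal_basis_def)
    have pos: "Re ?r \<ge> 0" "Im ?r = 0" "Re ?s \<ge> 0" "Im ?s = 0"
      using R S by (auto simp: psd_def complex_nonneg_Reals_iff)
    have "R *v ((R - S) *v b) + (R - S) *v (S *v b) = 0"
      using arg_cong[OF eq, of "\<lambda>M. M *v b"]
      by (simp add: matrix_vector_mult_diff_rdistrib matrix_vector_mult_diff_distrib
          flip: matrix_vector_mul_assoc)
    then have "0 = cinner b (R *v ((R - S) *v b)) + cinner b ((R - S) *v (S *v b))"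
      by (metis cinner_add_right cinner_diff_right diff_self)
    also have "\<dots> = of_real (l b) * (?r + ?s)"
      by (simp only: hermitian_cinner[OF H] l[OF b] matrix_scale_right cinner_scale_left
          cinner_scale_right distrib_left complex_cnj_complex_of_real)
    finally have "of_real (l b) * (?r + ?s) = 0" by simp
    moreover have "of_real (l b) = ?r - ?s"
      using bb l[OF b] by (metis cinner_diff_right cinner_scale_right matrix_vector_mult_diff_rdistrib mult.right_neutral)
    ultimately have "l b = 0"
      using pos by (auto simp: complex_eq_iff)
    then show "R *v b = S *v b"
      using l[OF b] by (simp add: matrix_vector_mult_diff_rdistrib)
  qed
qed

lemma trace_norm_hermitian:
  assumes H: "dagger H = H" and B: "orthonormal_basis B"
    and l: "\<And>b. b \<in> B \<Longrightarrow> H *v b = of_real (l b) *s b"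
  shows "trace_norm H = (\<Sum>b\<in>B. \<bar>l b\<bar>)"
proof -
  \<comment> \<open>The absolute value of \<open>H\<close>, built from its spectral decomposition;
    it is the positive square root of \<open>dagger H ** H\<close>.\<close>
  define R where "R = (\<chi> i j. \<Sum>b\<in>B. of_real \<bar>l b\<bar> * (b $ i * cnj (b $ j)))"
  have R: "R *v v = (\<Sum>b\<in>B. (of_real \<bar>l b\<bar> * cinner b v) *s b)" for v
    by (simp add: R_def vec_eq_iff matrix_vector_mult_def cinner_def sum_distrib_left
        sum_distrib_right sum.swap[of _ UNIV] algebra_simps)
  have Rb: "R *v c = of_real \<bar>l c\<bar> *s c" if "c \<in> B" for c
  proof -
    have "R *v c = (\<Sum>b\<in>B. if b = c then of_real \<bar>l b\<bar> *s b else 0)"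
      unfolding R using B that by (intro sum.cong) (auto simp: orthonormal_basis_def)
    then show ?thesis using B that by (simp add: orthonormal_basis_def)
  qed
  have "psd R"
    unfolding psd_def
  proof
    fix v
    have "cinner v (R *v v) = (\<Sum>b\<in>B. of_real (\<bar>l b\<bar> * (cmod (cinner b v))\<^sup>2))"
      unfolding R cinner_sum_right
    proof (rule sum.cong[OF refl])
      fix b
      show "cinner v ((of_real \<bar>l b\<bar> * cinner b v) *s b) = of_real (\<bar>l b\<bar> * (cmod (cinner b v))\<^sup>2)"
        using cinner_mult_commute[of b v] by (simp add: cinner_scale_right mult.assoc)
    qed
    then show "cinner v (R *v v) \<in> \<real>\<^sub>\<ge>\<^sub>0"
      by (simp add: complex_nonneg_Reals_iff sum_nonneg)
  qed
  moreover have "R ** R = dagger H ** H"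
    by (rule matrix_eq_on_basis[OF B])
      (simp add: H Rb l matrix_scale_right flip: matrix_vector_mul_assoc,
        simp add: vec_eq_iff flip: of_real_mult mult.assoc)
  ultimately have "psd_sqrt (dagger H ** H) = R"
    unfolding psd_sqrt_def by (intro the_equality) (auto intro: psd_sqrt_unique)
  then have "trace_norm H = Re (\<Sum>b\<in>B. cinner b (R *v b))"
    by (simp add: trace_norm_def trace_basis[OF B])
  also have "(\<Sum>b\<in>B. cinner b (R *v b)) = (\<Sum>b\<in>B. of_real \<bar>l b\<bar>)"
    using B by (intro sum.cong) (auto simp: Rb cinner_scale_right orthonormal_basis_def)
  finally show ?thesis by simp
qed

text \<open>In an eigenbasis of \<open>P - Q\<close> each eigenvalue is a difference of two
  nonnegative diagonal entries, so its modulus is at most their sum.\<close>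

lemma trace_norm_psd_diff_le:
  assumes P: "psd P" and Q: "psd Q"
  shows "trace_norm (P - Q) \<le> Re (trace P) + Re (trace Q)"
proof -
  have H: "dagger (P - Q) = P - Q"
    using P Q by (intro hermitian_diff psd_hermitian)
  obtain B l where B: "orthonormal_basis B"
    and l: "\<And>b. b \<in> B \<Longrightarrow> (P - Q) *v b = of_real (l b) *s b"
    using hermitian_eigenbasis[OF H] by blast
  have "\<bar>l b\<bar> \<le> Re (cinner b (P *v b)) + Re (cinner b (Q *v b))" if "b \<in> B" for b
  proof -
    have "cinner b b = 1"
      using B that by (simp add: orthonormal_basis_def)
    then have "of_real (l b) = cinner b (P *v b) - cinner b (Q *v b)"
      using l[OF that] by (metis cinner_diff_right cinner_scale_right matrix_vector_mult_diff_rdistrib mult.right_neutral)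
    then have "l b = Re (cinner b (P *v b)) - Re (cinner b (Q *v b))"
      by (metis Re_complex_of_real minus_complex.simps(1))
    moreover have "Re (cinner b (P *v b)) \<ge> 0" "Re (cinner b (Q *v b)) \<ge> 0"
      using P Q by (auto simp: psd_def complex_nonneg_Reals_iff)
    ultimately show ?thesis by linarith
  qed
  then have "(\<Sum>b\<in>B. \<bar>l b\<bar>) \<le> (\<Sum>b\<in>B. Re (cinner b (P *v b)) + Re (cinner b (Q *v b)))"
    by (rule sum_mono)
  then show ?thesis
    by (simp add: trace_norm_hermitian[OF H B l] trace_basis[OF B] sum.distrib)
qed

text \<open>The eigenvalues sum to zero, so the positive ones sum to half the trace norm. The
  expectation at \<open>v\<close> weights the eigenvalues by numbers in [0, 1] and so cannot exceed
  that sum.\<close>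

lemma trace_norm_traceless_ge:
  assumes H: "dagger H = H" and tr: "trace H = 0" and v: "cinner v v = 1"
  shows "2 * Re (cinner v (H *v v)) \<le> trace_norm H"
proof -
  obtain B l where B: "orthonormal_basis B"
    and l: "\<And>b. b \<in> B \<Longrightarrow> H *v b = of_real (l b) *s b"
    using hermitian_eigenbasis[OF H] by blast
  have fin: "finite B" using B by (simp add: orthonormal_basis_def)
  have sq: "cinner v b * cinner b v = of_real ((cmod (cinner b v))\<^sup>2)" for b
    by (metis cinner_mult_commute mult.commute)
  have "of_real (\<Sum>b\<in>B. (cmod (cinner b v))\<^sup>2) = (1::complex)"
    using cinner_basis[OF B, of v v] v by (simp add: sq)
  then have sum1: "(\<Sum>b\<in>B. (cmod (cinner b v))\<^sup>2) = 1"
    by (metis of_real_eq_1_iff)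
  have "cinner v (H *v v) = (\<Sum>b\<in>B. of_real (l b * (cmod (cinner b v))\<^sup>2))"
    unfolding cinner_basis[OF B, of v "H *v v"]
  proof (rule sum.cong[OF refl])
    fix b assume "b \<in> B"
    then have "cinner b (H *v v) = of_real (l b) * cinner b v"
      by (simp add: hermitian_cinner[OF H] l cinner_scale_left)
    then show "cinner v b * cinner b (H *v v) = of_real (l b * (cmod (cinner b v))\<^sup>2)"
      using sq[of b] by (simp add: mult.left_commute)
  qed
  then have "Re (cinner v (H *v v)) = (\<Sum>b\<in>B. l b * (cmod (cinner b v))\<^sup>2)"
    by simp
  \<comment> \<open>The summand on the right is the positive part of \<open>l b\<close>.\<close>
  also have "\<dots> \<le> (\<Sum>b\<in>B. (\<bar>l b\<bar> + l b) / 2)"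
  proof (rule sum_mono)
    fix b assume "b \<in> B"
    then have "(cmod (cinner b v))\<^sup>2 \<le> (\<Sum>b\<in>B. (cmod (cinner b v))\<^sup>2)"
      using fin by (intro member_le_sum) auto
    with sum1 have 1: "(cmod (cinner b v))\<^sup>2 \<le> 1" by simp
    have "l b * (cmod (cinner b v))\<^sup>2 \<le> (if l b \<ge> 0 then l b * 1 else 0)"
      using 1 by (simp add: mult_nonpos_nonneg mult_left_le)
    then show "l b * (cmod (cinner b v))\<^sup>2 \<le> (\<bar>l b\<bar> + l b) / 2"
      by (auto split: if_splits)
  qed
  also have "\<dots> = (\<Sum>b\<in>B. \<bar>l b\<bar>) / 2 + (\<Sum>b\<in>B. l b) / 2"
    by (simp add: sum.distrib add_divide_distrib sum_divide_distrib)
  also have "(\<Sum>b\<in>B. l b) = 0"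
  proof -
    have "trace H = (\<Sum>b\<in>B. of_real (l b))"
      unfolding trace_basis[OF B] using B
      by (intro sum.cong) (auto simp: l cinner_scale_right orthonormal_basis_def)
    then show ?thesis
      using tr by (simp flip: of_real_sum)
  qed
  finally show ?thesis
    by (simp add: trace_norm_hermitian[OF H B l])
qed

section \<open>Positivity and partial traces\<close>

lemma psd_diff_iff: "psd (M - N) \<longleftrightarrow> (\<forall>v. cinner v (M *v v) - cinner v (N *v v) \<in> \<real>\<^sub>\<ge>\<^sub>0)"
  by (simp add: psd_def matrix_vector_mult_diff_rdistrib cinner_diff_right)

lemma cscale_mult_vec: "cscale c M *v v = c *s (M *v v)"
  by (simp add: cscale_def map_matrix_def matrix_vector_mult_def vector_scalar_mult_def vec_eq_iff
      sum_distrib_left mult.assoc)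

lemma psd_cscale:
  assumes "psd M" "r \<ge> 0"
  shows "psd (cscale (of_real r) M)"
  using assms
  by (simp add: psd_def cscale_mult_vec cinner_scale_right complex_nonneg_Reals_iff)

lemma trace_cscale: "trace (cscale c M) = c * trace M"
  by (simp add: trace_def cscale_def map_matrix_def sum_distrib_left)

lemma sum_UNIV_prod: "(\<Sum>p\<in>UNIV. f p) = (\<Sum>x\<in>UNIV. \<Sum>y\<in>UNIV. f (x, y))"
  for f :: "'x::finite \<times> 'y::finite \<Rightarrow> 'z::comm_monoid_add"
  by (simp add: sum.cartesian_product)

lemma cinner_matrix: "cinner v (M *v w) = (\<Sum>i\<in>UNIV. \<Sum>j\<in>UNIV. cnj (v $ i) * M $ i $ j * w $ j)"
  by (simp add: cinner_def matrix_vector_mult_def sum_distrib_left mult.assoc)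

definition rank_one :: "complex ^ 'n \<Rightarrow> complex ^ 'n ^ 'n" where
  "rank_one v = (\<chi> i j. v $ i * cnj (v $ j))"

lemma rank_one_mult: "rank_one v *v w = cinner v w *s v"
  by (simp add: rank_one_def matrix_vector_mult_def cinner_def vec_eq_iff sum_distrib_left
      algebra_simps)

lemma rank_one_density:
  assumes "cinner v v = 1"
  shows "rank_one v \<in> density_ops"
proof -
  have "cinner w (rank_one v *v w) = of_real ((cmod (cinner v w))\<^sup>2)" for w
    using cinner_mult_commute[of v w] by (simp add: rank_one_mult cinner_scale_right)
  moreover have "trace (rank_one v) = 1"
    using assms by (simp add: trace_def rank_one_def cinner_def mult.commute)
  ultimately show ?thesis
    by (simp add: density_ops_def psd_def complex_nonneg_Reals_iff)
qed

text \<open>A Kraus form of the partial trace: the adjoint Kraus operators append a basis vector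
  \<open>e_y\<close>.\<close>

lemma cinner_tr_snd:
  "cinner v (tr_snd M *v w) =
     (\<Sum>y\<in>UNIV. cinner (tensor_vec v (axis y 1)) (M *v tensor_vec w (axis y 1)))"
proof -
  have *: "cinner (tensor_vec v (axis y 1)) (M *v tensor_vec w (axis y 1)) =
      (\<Sum>x\<in>UNIV. \<Sum>x'\<in>UNIV. cnj (v $ x) * M $ (x, y) $ (x', y) * w $ x')" for y
    unfolding cinner_matrix
    by (simp add: sum_UNIV_prod tensor_vec_def axis_def if_zero
        cong: if_cong)
  show ?thesis
    unfolding *
    by (simp add: cinner_matrix tr_snd_def sum_distrib_left sum_distrib_right, rule sum_rotate)
qed

lemma cinner_tr_fst:
  "cinner v (tr_fst M *v w) =
     (\<Sum>x\<in>UNIV. cinner (tensor_vec (axis x 1) v) (M *v tensor_vec (axis x 1) w))"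
proof -
  have *: "cinner (tensor_vec (axis x 1) v) (M *v tensor_vec (axis x 1) w) =
      (\<Sum>y\<in>UNIV. \<Sum>y'\<in>UNIV. cnj (v $ y) * M $ (x, y) $ (x, y') * w $ y')" for x
    unfolding cinner_matrix
    by (simp add: sum_UNIV_prod tensor_vec_def axis_def if_zero cong: if_cong)
  show ?thesis
    unfolding *
    by (simp add: cinner_matrix tr_fst_def sum_distrib_left sum_distrib_right, rule sum_rotate)
qed

text \<open>A basis-free form of the Kraus criterion: the \<open>K k\<close> play the role of the adjoints of the
  Kraus operators, but need not even be linear.\<close>

lemma completely_positiveI:
  fixes L :: "complex ^ 'x ^ 'x \<Rightarrow> complex ^ 'y ^ 'y"
  assumes K: "\<And>M v w. cinner v (L M *v w) = (\<Sum>k\<in>S. cinner (K k v) (M *v K k w))"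
  shows "completely_positive L"
  unfolding completely_positive_def
proof (intro allI impI)
  fix n and M :: "nat \<Rightarrow> nat \<Rightarrow> complex ^ 'x ^ 'x"
  assume M: "block_psd n M"
  show "block_psd n (\<lambda>i j. L (M i j))"
    unfolding block_psd_def
  proof
    fix v
    have "(\<Sum>i<n. \<Sum>j<n. cinner (v i) (L (M i j) *v v j)) =
        (\<Sum>i<n. \<Sum>k\<in>S. \<Sum>j<n. cinner (K k (v i)) (M i j *v K k (v j)))"
      unfolding K by (intro sum.cong sum.swap refl)
    also have "\<dots> = (\<Sum>k\<in>S. \<Sum>i<n. \<Sum>j<n. cinner (K k (v i)) (M i j *v K k (v j)))"
      by (rule sum.swap)
    \<comment> \<open>For each fixed \<open>k\<close> the double sum is the block form of
      \<open>M\<close> at the family \<open>K k (v i)\<close>.\<close>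
    also have "\<dots> \<in> \<real>\<^sub>\<ge>\<^sub>0"
      using M[unfolded block_psd_def, rule_format, of "\<lambda>i. K _ (v i)"]
      by (simp add: complex_nonneg_Reals_iff sum_nonneg)
    finally show "(\<Sum>i<n. \<Sum>j<n. cinner (v i) (L (M i j) *v v j)) \<in> \<real>\<^sub>\<ge>\<^sub>0" .
  qed
qed

lemma completely_positive_tr_snd: "completely_positive tr_snd"
  by (rule completely_positiveI, rule cinner_tr_snd)

lemma completely_positive_tr_fst: "completely_positive tr_fst"
  by (rule completely_positiveI, rule cinner_tr_fst)

text \<open>Matches the encoding in \<open>block_psd\<close>: \<open>id_tensor L\<close> applies
  \<open>L\<close> to each block, so identities for it can be checked blockwise.\<close>

definition block :: "complex ^ ('e::finite \<times> 'x::finite) ^ ('e \<times> 'x) \<Rightarrow> 'e \<Rightarrow> 'e \<Rightarrow> complex ^ 'x ^ 'x"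
  where "block M e e' = (\<chi> x x'. M $ (e, x) $ (e', x'))"

lemma block_id_tensor: "block (id_tensor L M) e e' = L (block M e e')"
  by (simp add: block_def id_tensor_def vec_lambda_eta)

lemma block_eqI: "(\<And>e e'. block M e e' = block N e e') \<Longrightarrow> M = N"
  by (auto simp: block_def vec_eq_iff)

lemma block_diff: "block (M - N) e e' = block M e e' - block N e e'"
  by (simp add: block_def vec_eq_iff)

lemma cinner_block:
  "cinner v (M *v w) = (\<Sum>e\<in>UNIV. \<Sum>e'\<in>UNIV.
     cinner (\<chi> x. v $ (e, x)) (block M e e' *v (\<chi> x. w $ (e', x))))"
  unfolding cinner_matrix
  by (simp add: sum_UNIV_prod block_def sum.swap[of _ "UNIV :: 'b set" "UNIV :: 'a set"])

text \<open>Complete positivity speaks of ancillas indexed by numbers below \<open>n\<close>,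
  \<open>id_tensor\<close> of one indexed by a finite type. An enumeration of that type carries one
  to the other.\<close>

lemma psd_id_tensor:
  fixes M :: "complex ^ ('e::finite \<times> 'x::finite) ^ ('e \<times> 'x)"
    and L :: "complex ^ 'x ^ 'x \<Rightarrow> complex ^ 'y::finite ^ 'y"
  assumes L: "completely_positive L" and M: "psd M"
  shows "psd (id_tensor L M)"
proof -
  define n where "n = CARD('e)"
  obtain h where h: "bij_betw h {..<n} (UNIV :: 'e set)"
    using ex_bij_betw_nat_finite[of "UNIV :: 'e set"] by (auto simp: n_def atLeast0LessThan)
  define g where "g = inv_into {..<n} h"
  have gh: "g (h i) = i" if "i < n" for i
    using h that by (simp add: g_def bij_betw_def inv_into_f_f)
  have reindex: "(\<Sum>i<n. \<Sum>j<n. F (h i) (h j)) = (\<Sum>e\<in>UNIV. \<Sum>e'\<in>UNIV. F e e')"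
    for F :: "'e \<Rightarrow> 'e \<Rightarrow> complex"
    using sum.reindex_bij_betw[OF h, of "\<lambda>e. \<Sum>e'\<in>UNIV. F e e'"]
    by (simp add: sum.reindex_bij_betw[OF h])
  have "block_psd n (\<lambda>i j. block M (h i) (h j))"
    unfolding block_psd_def
  proof
    fix v :: "nat \<Rightarrow> complex ^ 'x"
    define w where "w = (\<chi> p. v (g (fst p)) $ snd p)"
    have "(\<Sum>i<n. \<Sum>j<n. cinner (v i) (block M (h i) (h j) *v v j)) =
        (\<Sum>i<n. \<Sum>j<n. cinner (v (g (h i))) (block M (h i) (h j) *v v (g (h j))))"
      by (simp add: gh)
    also have "\<dots> = (\<Sum>e\<in>UNIV. \<Sum>e'\<in>UNIV. cinner (v (g e)) (block M e e' *v v (g e')))"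
      by (rule reindex)
    also have "\<dots> = cinner w (M *v w)"
      by (simp add: cinner_block w_def vec_lambda_eta)
    also have "\<dots> \<in> \<real>\<^sub>\<ge>\<^sub>0"
      using M by (simp add: psd_def)
    finally show "(\<Sum>i<n. \<Sum>j<n. cinner (v i) (block M (h i) (h j) *v v j)) \<in> \<real>\<^sub>\<ge>\<^sub>0" .
  qed
  then have LM: "block_psd n (\<lambda>i j. L (block M (h i) (h j)))"
    using L by (simp add: completely_positive_def)
  show ?thesis
    unfolding psd_def
  proof
    fix w :: "complex ^ ('e \<times> 'y)"
    have "cinner w (id_tensor L M *v w) = (\<Sum>i<n. \<Sum>j<n.
        cinner (\<chi> y. w $ (h i, y)) (L (block M (h i) (h j)) *v (\<chi> y. w $ (h j, y))))"
      unfolding cinner_block block_id_tensor by (rule reindex[symmetric])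
    then show "cinner w (id_tensor L M *v w) \<in> \<real>\<^sub>\<ge>\<^sub>0"
      using LM unfolding block_psd_def by simp
  qed
qed

section \<open>Traces and density operators under extended maps\<close>

lemma trace_block: "trace M = (\<Sum>e\<in>UNIV. trace (block M e e))"
  by (simp add: trace_def block_def sum_UNIV_prod)

lemma trace_id_tensor:
  assumes "\<And>M. trace (L M) = trace M"
  shows "trace (id_tensor L M) = trace M"
  by (simp add: trace_block block_id_tensor assms)

lemma trace_tr_snd: "trace (tr_snd M) = trace M"
  by (simp add: trace_def tr_snd_def sum_UNIV_prod)

lemma trace_tr_fst: "trace (tr_fst M) = trace M"
  by (simp add: trace_def tr_fst_def sum_UNIV_prod, rule sum.swap)

lemma density_id_tensor:
  assumes "completely_positive L" "\<And>M. trace (L M) = trace M" "\<rho> \<in> density_ops"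
  shows "id_tensor L \<rho> \<in> density_ops"
  using assms by (simp add: density_ops_def psd_id_tensor trace_id_tensor)

lemma density_diff_hermitian_traceless:
  assumes "\<rho> \<in> density_ops" "\<sigma> \<in> density_ops"
  shows "dagger (\<rho> - \<sigma>) = \<rho> - \<sigma>" "trace (\<rho> - \<sigma>) = 0"
  using assms by (auto simp: density_ops_def trace_sub intro: hermitian_diff psd_hermitian)

section \<open>Distance to a product with the maximally mixed state\<close>

text \<open>The operator is block diagonal in the second factor, so its form splits into the slices
  of \<open>w\<close>.\<close>

lemma cinner_tensor_op_mat:
  fixes T :: "complex ^ 'e ^ 'e" and w :: "complex ^ ('e::finite \<times> 'a::finite)"
  shows "cinner w (tensor_op T (mat c) *v w) =
    c * (\<Sum>a\<in>UNIV. cinner (\<chi> e. w $ (e, a)) (T *v (\<chi> e. w $ (e, a))))"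
proof -
  have "cinner w (tensor_op T (mat c) *v w) =
      (\<Sum>e\<in>UNIV. \<Sum>a\<in>UNIV. \<Sum>e'\<in>UNIV. c * (cnj (w $ (e, a)) * T $ e $ e' * w $ (e', a)))"
    unfolding cinner_matrix
    by (simp add: sum_UNIV_prod tensor_op_def mat_def if_zero algebra_simps
        cong: if_cong)
  also have "\<dots> = (\<Sum>a\<in>UNIV. \<Sum>e\<in>UNIV. \<Sum>e'\<in>UNIV. c * (cnj (w $ (e, a)) * T $ e $ e' * w $ (e', a)))"
    by (rule sum.swap)
  finally show ?thesis
    by (simp add: cinner_matrix sum_distrib_left)
qed

text \<open>The operator inequality \<open>\<rho> \<le> d\<^sub>A \<rho>\<^sub>E \<otimes> I\<close>: expanding \<open>w = \<Sum>\<^sub>a w\<^sub>a \<otimes> e\<^sub>a\<close>, it follows from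
  positivity of \<open>\<rho>\<close> on the differences \<open>w\<^sub>a \<otimes> e\<^sub>a - w\<^sub>b \<otimes> e\<^sub>b\<close>, summed over all \<open>a, b\<close>.\<close>

lemma psd_marginal_minus:
  fixes \<rho> :: "complex ^ ('e::finite \<times> 'a::finite) ^ ('e \<times> 'a)"
  assumes \<rho>: "psd \<rho>"
  shows "psd (tensor_op (tr_snd \<rho>) (mat (1 / of_nat CARD('a)))
    - cscale (of_real (1 / (real CARD('a))\<^sup>2)) \<rho>)"
  unfolding psd_diff_iff
proof
  fix w :: "complex ^ ('e \<times> 'a)"
  let ?d = "real CARD('a)"
  \<comment> \<open>The slice of \<open>w\<close> at \<open>a\<close>, attached to the basis vector
    \<open>k\<close>. The diagonal \<open>k = a\<close> rebuilds \<open>w\<close>; all pairs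
    together give the form of the marginal.\<close>
  define u where "u a k = tensor_vec (\<chi> e. w $ (e, a)) (axis k 1 :: complex ^ 'a)" for a k
  define q where "q v = Re (cinner v (\<rho> *v v))" for v
  have pos: "q v \<ge> 0" and im: "Im (cinner v (\<rho> *v v)) = 0" for v
    using \<rho> by (auto simp: q_def psd_def complex_nonneg_Reals_iff)
  have q: "cinner v (\<rho> *v v) = of_real (q v)" for v
    using im by (simp add: q_def complex_eq_iff)
  have \<tau>: "cinner w (tensor_op (tr_snd \<rho>) (mat (1 / of_nat CARD('a))) *v w) =
      of_real ((\<Sum>a\<in>UNIV. \<Sum>k\<in>UNIV. q (u a k)) / ?d)"
    by (simp add: cinner_tensor_op_mat cinner_tr_snd q flip: u_def)
  have w: "w = (\<Sum>a\<in>UNIV. u a a)"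
    by (simp add: u_def vec_eq_iff tensor_vec_def axis_def if_zero cong: if_cong)
  define r where "r a b = Re (cinner (u a a) (\<rho> *v u b b))" for a b
  have "cinner w (\<rho> *v w) = (\<Sum>a\<in>UNIV. \<Sum>b\<in>UNIV. cinner (u a a) (\<rho> *v u b b))"
    by (subst (1 2) w) (simp add: linear_sum[OF matrix_vector_mul_linear] cinner_sum_right
        cinner_sum_left, rule sum.swap)
  then have qw: "q w = (\<Sum>a\<in>UNIV. \<Sum>b\<in>UNIV. r a b)"
    by (simp add: q_def r_def)
  \<comment> \<open>Positivity on \<open>u a a - u b b\<close> bounds the cross terms by the
    diagonal ones.\<close>
  have "r a b + r b a \<le> q (u a a) + q (u b b)" for a b
    using pos[of "u a a - u b b"]
    by (simp add: q_def r_def matrix_vector_mult_diff_distrib cinner_diff_left cinner_diff_right)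
  then have "(\<Sum>a\<in>UNIV. \<Sum>b\<in>UNIV. r a b + r b a) \<le> (\<Sum>a\<in>UNIV. \<Sum>b\<in>UNIV. q (u a a) + q (u b b))"
    by (intro sum_mono)
  moreover have "(\<Sum>a\<in>UNIV. \<Sum>b\<in>UNIV. r a b + r b a) = 2 * q w"
    unfolding sum.distrib qw by (subst (2) sum.swap) simp
  moreover have "(\<Sum>a\<in>UNIV. \<Sum>b\<in>UNIV. q (u a a) + q (u b b)) = 2 * (?d * (\<Sum>a\<in>UNIV. q (u a a)))"
    by (simp add: sum.distrib sum_distrib_left)
  ultimately have "q w \<le> ?d * (\<Sum>a\<in>UNIV. q (u a a))"
    by simp
  \<comment> \<open>Adds the nonnegative terms with \<open>k \<noteq> a\<close> that the marginal
    contains.\<close>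
  also have "\<dots> \<le> ?d * (\<Sum>a\<in>UNIV. \<Sum>k\<in>UNIV. q (u a k))"
    by (intro mult_left_mono sum_mono member_le_sum) (auto simp: pos)
  finally have "q w / ?d\<^sup>2 \<le> (\<Sum>a\<in>UNIV. \<Sum>k\<in>UNIV. q (u a k)) / ?d"
    by (simp add: field_simps power2_eq_square)
  then show "cinner w (tensor_op (tr_snd \<rho>) (mat (1 / of_nat CARD('a))) *v w)
      - cinner w (cscale (of_real (1 / ?d\<^sup>2)) \<rho> *v w) \<in> \<real>\<^sub>\<ge>\<^sub>0"
    unfolding \<tau> cscale_mult_vec cinner_scale_right q
    by (simp add: complex_nonneg_Reals_iff flip: of_real_mult of_real_power of_real_diff of_real_divide)
qed

lemma trace_tensor_op: "trace (tensor_op M N) = trace M * trace N"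
  by (simp add: trace_def tensor_op_def sum_UNIV_prod sum_product)

lemma density_tensor_maximally_mixed:
  fixes \<rho> :: "complex ^ ('e::finite \<times> 'a::finite) ^ ('e \<times> 'a)"
  assumes "\<rho> \<in> density_ops"
  shows "tensor_op (tr_snd \<rho>) (mat (1 / of_nat CARD('a)) :: complex ^ 'a ^ 'a) \<in> density_ops"
  using assms
  by (auto simp: density_ops_def psd_def complex_nonneg_Reals_iff cinner_tensor_op_mat cinner_tr_snd
      trace_tensor_op trace_tr_snd sum_nonneg) (simp_all add: trace_def mat_def)

lemma trace_norm_marginal_le:
  fixes \<rho> :: "complex ^ ('e::finite \<times> 'a::finite) ^ ('e \<times> 'a)"
  assumes \<rho>: "\<rho> \<in> density_ops"
  shows "trace_norm (\<rho> - tensor_op (tr_snd \<rho>) (mat (1 / of_nat CARD('a)) :: complex ^ 'a ^ 'a))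
    \<le> 2 * ((real CARD('a))\<^sup>2 - 1) / (real CARD('a))\<^sup>2"
proof -
  let ?d = "real CARD('a)"
  let ?\<tau> = "tensor_op (tr_snd \<rho>) (mat (1 / of_nat CARD('a)) :: complex ^ 'a ^ 'a)"
  define s where "s = 1 / ?d\<^sup>2"
  have s: "0 \<le> 1 - s"
    by (simp add: s_def divide_le_eq Suc_le_eq)
  \<comment> \<open>The common part \<open>s \<rho>\<close> is removed from both states, leaving two
    positive operators of trace \<open>1 - s\<close>.\<close>
  define P Q where "P = cscale (of_real (1 - s)) \<rho>" and "Q = ?\<tau> - cscale (of_real s) \<rho>"
  have tr: "trace \<rho> = 1" "trace ?\<tau> = 1"
    using \<rho> density_tensor_maximally_mixed[OF \<rho>] by (auto simp: density_ops_def)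
  have psd: "psd P" "psd Q"
    using \<rho> s psd_marginal_minus[of \<rho>] psd_cscale[of \<rho> "1 - s"]
    by (auto simp: P_def Q_def density_ops_def s_def)
  have "\<rho> - ?\<tau> = P - Q"
    by (simp add: P_def Q_def cscale_def map_matrix_def vec_eq_iff algebra_simps)
  then have "trace_norm (\<rho> - ?\<tau>) \<le> Re (trace P) + Re (trace Q)"
    using trace_norm_psd_diff_le[OF psd] by simp
  also have "\<dots> = 2 * (1 - s)"
    by (simp add: P_def Q_def trace_cscale trace_sub tr)
  also have "\<dots> = 2 * (?d\<^sup>2 - 1) / ?d\<^sup>2"
    by (simp add: s_def field_simps)
  finally show ?thesis .
qed

text \<open>Test the traceless difference on \<open>\<psi>\<close> itself: the projector contributes
  1 and \<open>\<sigma>\<close> contributes \<open>1 / d\<^sup>2\<close>.\<close>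

lemma trace_norm_rank_one_minus_ge:
  assumes \<psi>: "cinner \<psi> \<psi> = 1" and \<sigma>: "\<sigma> \<in> density_ops"
    and ov: "cinner \<psi> (\<sigma> *v \<psi>) = of_real (1 / d\<^sup>2)" and d: "d \<noteq> 0"
  shows "2 * (d\<^sup>2 - 1) / d\<^sup>2 \<le> trace_norm (rank_one \<psi> - \<sigma>)"
proof -
  note H = density_diff_hermitian_traceless[OF rank_one_density[OF \<psi>] \<sigma>]
  have "cinner \<psi> ((rank_one \<psi> - \<sigma>) *v \<psi>) = of_real (1 - 1 / d\<^sup>2)"
    using \<psi> ov by (simp add: matrix_vector_mult_diff_rdistrib cinner_diff_right rank_one_mult
        cinner_scale_right)
  then have "2 * (1 - 1 / d\<^sup>2) \<le> trace_norm (rank_one \<psi> - \<sigma>)"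
    using trace_norm_traceless_ge[OF H \<psi>] by (simp only: Re_complex_of_real)
  then show ?thesis
    using d by (simp add: field_simps)
qed

section \<open>Maximally entangled states\<close>

lemma maximally_entangled_density: "maximally_entangled \<rho> \<Longrightarrow> \<rho> \<in> density_ops"
  using rank_one_density by (auto simp: maximally_entangled_def pure_state_def rank_one_def)

lemma tensor_op_mat: "tensor_op (mat a) (mat b) = mat (a * b)"
  by (auto simp: tensor_op_def mat_def vec_eq_iff)

lemma maximally_entangled_trace_norm:
  fixes \<rho> :: "complex ^ ('a::finite \<times> 'a) ^ ('a \<times> 'a)"
  assumes \<rho>: "maximally_entangled \<rho>"
  shows "trace_norm (\<rho> - tensor_op (tr_snd \<rho>) (mat (1 / of_nat CARD('a)) :: complex ^ 'a ^ 'a))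
    = 2 * ((real CARD('a))\<^sup>2 - 1) / (real CARD('a))\<^sup>2"
proof (rule antisym)
  have dens: "\<rho> \<in> density_ops"
    using \<rho> by (rule maximally_entangled_density)
  then show "trace_norm (\<rho> - tensor_op (tr_snd \<rho>) (mat (1 / of_nat CARD('a)) :: complex ^ 'a ^ 'a))
    \<le> 2 * ((real CARD('a))\<^sup>2 - 1) / (real CARD('a))\<^sup>2"
    by (rule trace_norm_marginal_le)
  obtain \<psi> where \<psi>: "cinner \<psi> \<psi> = 1" "\<rho> = rank_one \<psi>"
    using \<rho> by (auto simp: maximally_entangled_def pure_state_def rank_one_def)
  have "tr_snd \<rho> = mat (1 / of_nat CARD('a))"
    using \<rho> by (simp add: maximally_entangled_def maximally_mixed_def)
  \<comment> \<open>The product is the identity over \<open>d\<^sup>2\<close>, so its overlap with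
    every unit vector is \<open>1 / d\<^sup>2\<close>.\<close>
  then have "tensor_op (tr_snd \<rho>) (mat (1 / of_nat CARD('a)) :: complex ^ 'a ^ 'a) *v \<psi>
      = of_real (1 / (real CARD('a))\<^sup>2) *s \<psi>"
    by (simp add: tensor_op_mat mat_mult_vec power2_eq_square)
  then show "2 * ((real CARD('a))\<^sup>2 - 1) / (real CARD('a))\<^sup>2
      \<le> trace_norm (\<rho> - tensor_op (tr_snd \<rho>) (mat (1 / of_nat CARD('a)) :: complex ^ 'a ^ 'a))"
    using trace_norm_rank_one_minus_ge[OF \<psi>(1) density_tensor_maximally_mixed[OF dens]]
    by (simp add: \<psi> cinner_scale_right)
qed

text \<open>The witness is the normalized sum of the vectors \<open>e_i \<otimes> e_i\<close>; its
  existence makes the maximum attained.\<close>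

lemma ex_maximally_entangled:
  "\<exists>\<rho> :: complex ^ ('a::finite \<times> 'a) ^ ('a \<times> 'a). maximally_entangled \<rho>"
proof -
  define c where "c = complex_of_real (1 / sqrt (real CARD('a)))"
  define \<psi> :: "complex ^ ('a \<times> 'a)" where "\<psi> = (\<chi> p. if fst p = snd p then c else 0)"
  have c: "c * cnj c = 1 / of_nat CARD('a)"
    by (simp add: c_def flip: of_real_mult)
  have "cinner \<psi> \<psi> = 1"
    using c by (simp add: cinner_def \<psi>_def sum_UNIV_prod if_zero mult.commute
        cong: if_cong)
  moreover have "tr_snd (rank_one \<psi>) = maximally_mixed"
    using c by (simp add: tr_snd_def rank_one_def \<psi>_def maximally_mixed_def mat_def vec_eq_iff
        if_zero cong: if_cong)
  moreover have "tr_fst (rank_one \<psi>) = maximally_mixed"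
    using c by (simp add: tr_fst_def rank_one_def \<psi>_def maximally_mixed_def mat_def vec_eq_iff
        if_zero cong: if_cong)
  ultimately have "maximally_entangled (rank_one \<psi>)"
    unfolding maximally_entangled_def pure_state_def rank_one_def by blast
  then show ?thesis by blast
qed

section \<open>Signalling of the SWAP gate\<close>

text \<open>After the swap Alice's output holds Bob's input, so discarding it leaves Alice's
  input.\<close>

lemma tr_fst_swap: "tr_fst (unitary_channel swap_op M) = tr_snd M"
proof -
  have "unitary_channel swap_op M $ p $ q = M $ (snd p, fst p) $ (snd q, fst q)" for p q
  proof -
    have s: "(fst p = snd r \<and> snd p = fst r) \<longleftrightarrow> r = (snd p, fst p)"
      for p :: "'b \<times> 'a" and r by (auto simp: prod_eq_iff)
    show ?thesis
      by (simp add: unitary_channel_def matrix_matrix_mult_def dagger_def transpose_def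
          map_matrix_def swap_op_def s if_zero cong: if_cong)
  qed
  then show ?thesis
    by (simp add: tr_fst_def tr_snd_def)
qed

text \<open>If \<open>C\<close> is a channel and \<open>\<rho>\<close> a state, the right-hand side
  is a difference of two states.\<close>

lemma id_tensor_swap_difference:
  fixes \<rho> :: "complex ^ ('e::finite \<times> ('a::finite \<times> 'b::finite)) ^ ('e \<times> ('a \<times> 'b))"
  shows
  "id_tensor (\<lambda>M. tr_fst (unitary_channel swap_op M) - C (tr_fst M)) \<rho> =
     id_tensor tr_snd \<rho> - id_tensor C (id_tensor tr_fst \<rho>)"
proof (rule block_eqI)
  fix e e' :: 'e
  show "block (id_tensor (\<lambda>M. tr_fst (unitary_channel swap_op M) - C (tr_fst M)) \<rho>) e e' =
      block (id_tensor tr_snd \<rho> - id_tensor C (id_tensor tr_fst \<rho>)) e e'"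
    by (simp add: block_id_tensor block_diff tr_fst_swap)
qed

text \<open>Discards the input and prepares the maximally mixed state; this channel attains the
  infimum in the signalling.\<close>

definition depolarizing :: "complex ^ 'b ^ 'b \<Rightarrow> complex ^ 'a ^ 'a" where
  "depolarizing M = mat (trace M / of_nat CARD('a))"

lemma depolarizing_channel:
  "(depolarizing :: complex ^ 'b ^ 'b \<Rightarrow> complex ^ 'a ^ 'a) \<in> channels"
proof -
  have "Vector_Spaces.linear cscale cscale (depolarizing :: complex ^ 'b ^ 'b \<Rightarrow> complex ^ 'a ^ 'a)"
    by unfold_locales
      (auto simp: cscale_def map_matrix_def depolarizing_def mat_def trace_def vec_eq_iff
        sum.distrib sum_distrib_left add_divide_distrib algebra_simps)
  moreover have "completely_positive (depolarizing :: complex ^ 'b ^ 'b \<Rightarrow> complex ^ 'a ^ 'a)"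
  proof (rule completely_positiveI)
    fix M :: "complex ^ 'b ^ 'b" and v w :: "complex ^ 'a"
    \<comment> \<open>Normalizes the Kraus operators \<open>c |l><k|\<close>, whose adjoints send
      \<open>v\<close> to \<open>c v_l e_k\<close>.\<close>
    define c where "c = complex_of_real (1 / sqrt (real CARD('a)))"
    have c: "cnj c * c = 1 / of_nat CARD('a)"
      by (simp add: c_def flip: of_real_mult)
    have "cinner ((c * v $ l) *s axis k 1) (M *v ((c * w $ l) *s axis k 1)) =
        (cnj c * c) * (cnj (v $ l) * w $ l * M $ k $ k)" for k l
      by (simp add: matrix_scale_right cinner_scale_left cinner_scale_right
          flip: matrix_entry_eq_cinner)
    then have "(\<Sum>p\<in>UNIV. cinner ((c * v $ snd p) *s axis (fst p) 1)
          (M *v ((c * w $ snd p) *s axis (fst p) 1))) =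
        (\<Sum>k\<in>UNIV. \<Sum>l\<in>UNIV. 1 / of_nat CARD('a) * (cnj (v $ l) * w $ l * M $ k $ k))"
      by (simp add: sum_UNIV_prod c)
    also have "\<dots> = trace M / of_nat CARD('a) * cinner v w"
      by (simp add: trace_def cinner_def sum_product sum_divide_distrib mult_ac, rule sum.swap)
    also have "\<dots> = cinner v (depolarizing M *v w)"
      by (simp add: depolarizing_def mat_mult_vec cinner_scale_right)
    finally show "cinner v (depolarizing M *v w) = (\<Sum>p\<in>(UNIV :: ('b \<times> 'a) set).
        cinner ((c * v $ snd p) *s axis (fst p) 1) (M *v ((c * w $ snd p) *s axis (fst p) 1)))"
      by simp
  qed
  moreover have "trace (depolarizing M :: complex ^ 'a ^ 'a) = trace M" for M :: "complex ^ 'b ^ 'b"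
    by (simp add: depolarizing_def trace_def mat_def)
  ultimately show ?thesis
    by (simp add: channels_def)
qed

text \<open>Brings the subtracted term into the product form to which
  \<open>trace_norm_marginal_le\<close> applies.\<close>

lemma id_tensor_depolarizing:
  fixes \<rho> :: "complex ^ ('e::finite \<times> ('a::finite \<times> 'b::finite)) ^ ('e \<times> ('a \<times> 'b))"
  shows "id_tensor depolarizing (id_tensor tr_fst \<rho>) =
    tensor_op (tr_snd (id_tensor tr_snd \<rho>)) (mat (1 / of_nat CARD('a)) :: complex ^ 'a ^ 'a)"
proof -
  have "(\<Sum>b\<in>UNIV. \<Sum>a\<in>UNIV. \<rho> $ (e, a, b) $ (e', a, b)) =
      (\<Sum>a\<in>UNIV. \<Sum>b\<in>UNIV. \<rho> $ (e, a, b) $ (e', a, b))" for e e'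
    by (rule sum.swap)
  then show ?thesis
    by (simp add: vec_eq_iff id_tensor_def tensor_op_def depolarizing_def tr_fst_def tr_snd_def
        trace_def mat_def)
qed

section \<open>Lower and upper bounds on the diamond norm\<close>

lemma channel_density:
  assumes "C \<in> channels" "\<rho> \<in> density_ops"
  shows "id_tensor C (id_tensor tr_fst \<rho>) \<in> density_ops"
  using assms
  by (auto simp: channels_def intro!: density_id_tensor completely_positive_tr_fst trace_tr_fst)

lemma density_ops_nonempty: "density_ops \<noteq> {}"
proof -
  have "rank_one (axis undefined 1) \<in> density_ops"
    by (intro rank_one_density) (simp add: cinner_axis_left)
  then show ?thesis by blast
qed

lemma swap_diamond_norm_ge:
  fixes C :: "complex ^ 'b::finite ^ 'b \<Rightarrow> complex ^ 'a::finite ^ 'a"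
  assumes C: "C \<in> channels"
  shows "2 * ((real CARD('a))\<^sup>2 - 1) / (real CARD('a))\<^sup>2 \<le>
    diamond_norm (\<lambda>M. tr_fst (unitary_channel swap_op M) - C (tr_fst M))"
proof -
  define c where "c = complex_of_real (1 / sqrt (real CARD('a)))"
  have c: "cnj c * c = 1 / of_nat CARD('a)" "c * cnj c = 1 / of_nat CARD('a)"
    by (simp_all add: c_def flip: of_real_mult)
  \<comment> \<open>An arbitrary basis index for Bob's input.\<close>
  define b :: 'b where "b = undefined"
  \<comment> \<open>The reference system has the size of \<open>AB\<close>; its \<open>A\<close> part is maximally entangled with \<open>A\<close>,
    and its \<open>B\<close> part is idle in the state \<open>b\<close>.\<close>
  define \<psi> :: "complex ^ (('a \<times> 'b) \<times> ('a \<times> 'b))" where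
    "\<psi> = (\<chi> p. if fst (snd p) = fst (fst p)
      then if snd (fst p) = b then if snd (snd p) = b then c else 0 else 0 else 0)"
  define \<phi> :: "complex ^ (('a \<times> 'b) \<times> 'a)" where
    "\<phi> = (\<chi> p. if snd p = fst (fst p) then if snd (fst p) = b then c else 0 else 0)"
  have "cnj (\<psi> $ ((x, y), (x', y'))) * \<psi> $ ((x, y), (x', y')) = (if x' = x then
      if y = b then if y' = b then 1 / of_nat CARD('a) else 0 else 0 else 0)" for x y x' y'
    by (simp add: \<psi>_def c)
  then have \<psi>: "cinner \<psi> \<psi> = 1"
    by (simp add: cinner_def sum_UNIV_prod if_zero(5))
  have "cnj (\<phi> $ ((x, y), x')) * \<phi> $ ((x, y), x') = (if x' = x then
      if y = b then 1 / of_nat CARD('a) else 0 else 0)" for x y x'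
    by (simp add: \<phi>_def c)
  then have \<phi>: "cinner \<phi> \<phi> = 1"
    by (simp add: cinner_def sum_UNIV_prod if_zero(5))
  have marg: "id_tensor tr_snd (rank_one \<psi>) = rank_one \<phi>"
    by (simp add: vec_eq_iff id_tensor_def tr_snd_def rank_one_def \<psi>_def \<phi>_def if_zero
        cong: if_cong)
  define \<sigma> where "\<sigma> = id_tensor C (id_tensor tr_fst (rank_one \<psi>))"
  have \<sigma>: "\<sigma> \<in> density_ops"
    unfolding \<sigma>_def by (intro channel_density C rank_one_density \<psi>)
  have lin: "Vector_Spaces.linear cscale cscale C" and tr: "trace (C M) = trace M" for M
    using C by (auto simp: channels_def)
  interpret Vector_Spaces.linear cscale cscale C by (rule lin)
  define \<beta> :: "complex ^ 'b ^ 'b" where "\<beta> = rank_one (axis b 1)"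
  \<comment> \<open>Discarding \<open>A\<close> leaves its reference copy maximally mixed and in a
    product with Bob's state \<open>\<beta>\<close>. Blocks with reference index \<open>b\<close>
    suffice, since \<open>\<phi>\<close> vanishes elsewhere.\<close>
  have bl: "block (id_tensor tr_fst (rank_one \<psi>)) (x, b) (x', b) =
      (if x = x' then cscale (1 / of_nat CARD('a)) \<beta> else 0)" for x x'
    using c by (auto simp: vec_eq_iff block_def id_tensor_def tr_fst_def rank_one_def \<psi>_def \<beta>_def
        cscale_def map_matrix_def axis_def if_zero cong: if_cong)
  have \<sigma>_entry: "\<sigma> $ ((x, b), y) $ ((x', b), y') =
      (if x = x' then C \<beta> $ y $ y' / of_nat CARD('a) else 0)" for x x' y y'
  proof -
    have "\<sigma> $ ((x, b), y) $ ((x', b), y') = block \<sigma> (x, b) (x', b) $ y $ y'"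
      by (simp add: block_def)
    also have "\<dots> = (if x = x' then C \<beta> $ y $ y' / of_nat CARD('a) else 0)"
      unfolding \<sigma>_def block_id_tensor[of C] bl
      by (simp add: zero scale) (simp add: cscale_def map_matrix_def)
    finally show ?thesis .
  qed
  have "cinner \<phi> (\<sigma> *v \<phi>) = (\<Sum>x\<in>UNIV. cnj c * (C \<beta> $ x $ x / of_nat CARD('a)) * c)"
    unfolding cinner_matrix
    by (simp add: sum_UNIV_prod \<phi>_def \<sigma>_entry if_zero cong: if_cong)
  also have "\<dots> = trace (C \<beta>) * (cnj c * c) / of_nat CARD('a)"
    by (simp add: trace_def sum_distrib_left sum_distrib_right sum_divide_distrib mult_ac)
  also have "\<dots> = of_real (1 / (real CARD('a))\<^sup>2)"
  proof -
    have "\<beta> \<in> density_ops"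
      unfolding \<beta>_def by (intro rank_one_density) (simp add: cinner_axis_left)
    then show ?thesis
      by (simp add: tr c density_ops_def power2_eq_square)
  qed
  finally have ov: "cinner \<phi> (\<sigma> *v \<phi>) = of_real (1 / (real CARD('a))\<^sup>2)" .
  let ?L = "\<lambda>M. tr_fst (unitary_channel swap_op M) - C (tr_fst M)"
  have "2 * ((real CARD('a))\<^sup>2 - 1) / (real CARD('a))\<^sup>2 \<le> trace_norm (id_tensor ?L (rank_one \<psi>))"
    unfolding id_tensor_swap_difference marg \<sigma>_def[symmetric]
    by (rule trace_norm_rank_one_minus_ge[OF \<phi> \<sigma> ov]) simp
  \<comment> \<open>A real supremum dominates its members only when bounded; the bound 2 holds for
    any difference of two states.\<close>
  also have "\<dots> \<le> diamond_norm ?L"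
    unfolding diamond_norm_def
  proof (rule cSUP_upper[OF rank_one_density[OF \<psi>]], rule bdd_aboveI2)
    fix \<rho> :: "complex ^ (('a \<times> 'b) \<times> ('a \<times> 'b)) ^ (('a \<times> 'b) \<times> ('a \<times> 'b))"
    assume "\<rho> \<in> density_ops"
    then have "id_tensor tr_snd \<rho> \<in> density_ops" "id_tensor C (id_tensor tr_fst \<rho>) \<in> density_ops"
      using C by (auto intro: density_id_tensor completely_positive_tr_snd trace_tr_snd channel_density)
    then show "trace_norm (id_tensor ?L \<rho>) \<le> 2"
      unfolding id_tensor_swap_difference
      using trace_norm_psd_diff_le[of "id_tensor tr_snd \<rho>" "id_tensor C (id_tensor tr_fst \<rho>)"]
      by (simp add: density_ops_def)
  qed
  finally show ?thesis .
qed

text \<open>The reference now has the size of \<open>AB\<close>, but the bound of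
  \<open>trace_norm_marginal_le\<close> depends only on the dimension of \<open>A\<close>.\<close>

lemma swap_diamond_norm_depolarizing_le:
  "diamond_norm (\<lambda>M. tr_fst (unitary_channel swap_op M) -
      (depolarizing :: complex ^ 'b::finite ^ 'b \<Rightarrow> complex ^ 'a::finite ^ 'a) (tr_fst M))
    \<le> 2 * ((real CARD('a))\<^sup>2 - 1) / (real CARD('a))\<^sup>2"
  unfolding diamond_norm_def id_tensor_swap_difference id_tensor_depolarizing
  by (intro cSUP_least density_ops_nonempty trace_norm_marginal_le density_id_tensor
      completely_positive_tr_snd trace_tr_snd)

lemma signalling_swap:
  "signalling (swap_op :: complex ^ ('a::finite \<times> 'b::finite) ^ ('b \<times> 'a)) =
    2 * ((real CARD('a))\<^sup>2 - 1) / (real CARD('a))\<^sup>2"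
  unfolding signalling_def
proof (rule cInf_eq_minimum)
  let ?D = "\<lambda>C. diamond_norm (\<lambda>M.
      tr_fst (unitary_channel (swap_op :: complex ^ ('a \<times> 'b) ^ ('b \<times> 'a)) M) - C (tr_fst M))"
  have "?D depolarizing = 2 * ((real CARD('a))\<^sup>2 - 1) / (real CARD('a))\<^sup>2"
    by (intro antisym swap_diamond_norm_depolarizing_le swap_diamond_norm_ge depolarizing_channel)
  then show "2 * ((real CARD('a))\<^sup>2 - 1) / (real CARD('a))\<^sup>2 \<in> ?D ` channels"
    by (rule image_eqI[OF sym depolarizing_channel])
  fix y
  assume "y \<in> ?D ` channels"
  then show "2 * ((real CARD('a))\<^sup>2 - 1) / (real CARD('a))\<^sup>2 \<le> y"
    by (elim imageE) (simp only: swap_diamond_norm_ge)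
qed

theorem theorem3p2:
  shows "let S = (swap_op :: complex ^ ('a::finite \<times> 'b::finite) ^ ('b \<times> 'a));
             f = (\<lambda>\<rho> :: complex ^ ('a \<times> 'a) ^ ('a \<times> 'a).
                    trace_norm (\<rho> - tensor_op (tr_snd \<rho>) (mat (1 / of_nat CARD('a)) :: complex ^ 'a ^ 'a)))
         in signalling S = 2 * ((real CARD('a))\<^sup>2 - 1) / (real CARD('a))\<^sup>2
            \<and> (signalling S \<in> f ` density_ops \<and> (\<forall>\<rho>\<in>density_ops. f \<rho> \<le> signalling S))
            \<and> (\<forall>\<rho>. maximally_entangled \<rho> \<longrightarrow> is_arg_max f (\<lambda>\<sigma>. \<sigma> \<in> density_ops) \<rho>)"
proof -
  define f where "f = (\<lambda>\<rho> :: complex ^ ('a \<times> 'a) ^ ('a \<times> 'a).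
      trace_norm (\<rho> - tensor_op (tr_snd \<rho>) (mat (1 / of_nat CARD('a)) :: complex ^ 'a ^ 'a)))"
  let ?s = "2 * ((real CARD('a))\<^sup>2 - 1) / (real CARD('a))\<^sup>2"
  \<comment> \<open>With a reference of the size of \<open>A\<close> the same upper bound holds, and
    maximally entangled states reach it, so this maximum equals the signalling.\<close>
  have le: "f \<rho> \<le> ?s" if "\<rho> \<in> density_ops" for \<rho>
    unfolding f_def using that by (rule trace_norm_marginal_le)
  have eq: "f \<rho> = ?s" if "maximally_entangled \<rho>" for \<rho>
    unfolding f_def using that by (rule maximally_entangled_trace_norm)
  obtain \<rho>0 :: "complex ^ ('a \<times> 'a) ^ ('a \<times> 'a)" where "maximally_entangled \<rho>0"
    using ex_maximally_entangled by blast
  then have "?s \<in> f ` density_ops"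
    using eq maximally_entangled_density by (metis image_eqI)
  moreover have "is_arg_max f (\<lambda>\<sigma>. \<sigma> \<in> density_ops) \<rho>" if "maximally_entangled \<rho>" for \<rho>
    using that le by (force simp: is_arg_max_def eq maximally_entangled_density)
  ultimately show ?thesis
    using le by (simp only: Let_def signalling_swap flip: f_def) blast
qed

end
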